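(* For every real number $z>-\log 2$, $$\sum_{k\ge2}\frac{(-1)^k}{k(\log k+z)}+\sum_{k\ge2}\frac{\log 2}{k(\log k+z)(\log(2k)+z)}=\frac{1}{\log 2+z}.$$ In particular, for every real number $\alpha>\frac12$ (taking $z=\log\alpha$), $$\sum_{k\ge2}\frac{(-1)^k}{k\log(\alpha k)}+\sum_{k\ge2}\frac{\log 2}{k\log(\alpha k)\log(2\alpha k)}=\frac{1}{\log(2\alpha)}.$$
   Context: Here $\log$ is the natural logarithm, and the infinite sums are over integers $k\ge 2$, taken as limits of partial sums. *)

theory Defs
  imports Complex_Main
begin

end

theory Submission
  imports Defs
begin

text \<open>
  Put \<open>f k = 1 / (k * (ln k + z))\<close>. Since \<open>ln (2 * k) + z\<close> exceeds \<open>ln k + z\<close> by \<open>ln 2\<close>,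
  partial fractions turn the terms of the second series into \<open>f k - 2 * f (2 * k)\<close>. In the
  alternating series, the even terms may be counted twice with the sum of all \<open>f k\<close> subtracted,
  so that \<open>2 * f (2 * k)\<close> and \<open>f k\<close> both occur with opposite signs in the two series. If the
  alternating series is cut at twice the length of the other, everything cancels except
  \<open>2 * f 2 = 1 / (ln 2 + z)\<close> and a block of \<open>f k\<close> with \<open>k\<close> between \<open>N\<close> and \<open>2 * N\<close>
  (lemma \<open>alternating_plus_doubling_partial_sums\<close>). As \<open>f\<close> decreases, that block is at most about \<open>N * f N = 1 / (ln N + z)\<close>,
  which tends to \<open>0\<close>. The alternating series converges by the Leibniz criterion, and the
  identity of partial sums then gives the convergence of the other series as well as its value.
  The argument uses of \<open>f\<close> only that it decreases and that \<open>k * f k\<close> tends to \<open>0\<close>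
  (lemma \<open>alternating_plus_doubling_sums\<close>); the second half of the theorem is the case \<open>z = ln \<alpha>\<close>.
\<close>

text \<open>
  The block on the right runs over \<open>f k\<close> for \<open>N + 2 \<le> k \<le> 2 * N + 3\<close>. Raising \<open>N\<close> by one removes
  \<open>f (N + 2)\<close> from it and adds the two consecutive values starting at \<open>f (2 * N + 4)\<close>, which is
  what the new terms on the left contribute.
\<close>

lemma alternating_plus_doubling_partial_sums:
  fixes f :: "nat \<Rightarrow> real"
  shows "(\<Sum>n<2*N+2. (-1)^n * f (n+2)) + (\<Sum>n<N. f (n+2) - 2 * f (2*(n+2)))
         = 2 * f 2 - (\<Sum>n=N..<2*N+2. f (n+2))"
proof (induction N)
  case 0
  show ?case by (simp add: numeral_2_eq_2)
next
  case (Suc N)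
  have "(\<Sum>n<2*Suc N+2. (-1)^n * f (n+2))
        = (\<Sum>n<2*N+2. (-1)^n * f (n+2)) + f (2*N+4) - f (2*N+5)"
    by (simp add: numeral_eq_Suc power_add)
  moreover have "(\<Sum>n=Suc N..<2*Suc N+2. f (n+2))
        = (\<Sum>n=N..<2*N+2. f (n+2)) - f (N+2) + f (2*N+4) + f (2*N+5)"
    using sum.atLeast_Suc_lessThan[of N "2*N+2" "\<lambda>n. f (n+2)"]
    by (simp add: numeral_eq_Suc)
  moreover have "(\<Sum>n<Suc N. f (n+2) - 2 * f (2*(n+2)))
        = (\<Sum>n<N. f (n+2) - 2 * f (2*(n+2))) + f (N+2) - 2 * f (2*N+4)"
    by (simp add: numeral_eq_Suc)
  ultimately show ?case
    using Suc by linarith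
qed

text \<open>
  The second series converges because its partial sums are a constant
  minus a block that vanishes in the limit, minus partial sums of a convergent alternating series.
  The block has \<open>N + 2\<close> terms, each at most \<open>f (N + 2)\<close>, hence the need for
  \<open>k * f k\<close> rather than just \<open>f k\<close> to tend to \<open>0\<close>.
\<close>

lemma alternating_plus_doubling_sums:
  fixes f :: "nat \<Rightarrow> real"
  assumes dec: "\<And>m n. 2 \<le> m \<Longrightarrow> m \<le> n \<Longrightarrow> f n \<le> f m"
    and pos: "\<And>n. 2 \<le> n \<Longrightarrow> 0 \<le> f n"
    and lim: "(\<lambda>n. real n * f n) \<longlonglongrightarrow> 0"
  shows "summable (\<lambda>n. (-1)^n * f (n+2))"
    and "(\<lambda>n. f (n+2) - 2 * f (2*(n+2))) sums (2 * f 2 - (\<Sum>n. (-1)^n * f (n+2)))"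
proof -
  have lim': "(\<lambda>N. real (N+2) * f (N+2)) \<longlonglongrightarrow> 0"
    using LIMSEQ_ignore_initial_segment[OF lim] .
  have "(\<lambda>N. f (N+2)) \<longlonglongrightarrow> 0"
  proof (rule tendsto_sandwich[OF _ _ tendsto_const lim'])
    have "1 * f (N+2) \<le> real (N+2) * f (N+2)" for N
      by (rule mult_right_mono) (auto intro: pos)
    then show "\<forall>\<^sub>F N in sequentially. f (N+2) \<le> real (N+2) * f (N+2)"
      by simp
  qed (simp add: pos)
  moreover have "monoseq (\<lambda>n. f (n+2))"
    by (rule monoI2) (auto intro: dec)
  ultimately show summ: "summable (\<lambda>n. (-1)^n * f (n+2))"
    by (rule summable_Leibniz(1))
  have block: "(\<lambda>N. \<Sum>n=N..<2*N+2. f (n+2)) \<longlonglongrightarrow> 0"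
  proof (rule tendsto_sandwich[OF _ _ tendsto_const lim'])
    have "(\<Sum>n=N..<2*N+2. f (n+2)) \<le> real (N+2) * f (N+2)" for N
    proof -
      have "(\<Sum>n=N..<2*N+2. f (n+2)) \<le> real (card {N..<2*N+2}) * f (N+2)"
        by (rule sum_bounded_above) (auto intro: dec)
      then show ?thesis
        by (simp del: sum.op_ivl_Suc)
    qed
    then show "\<forall>\<^sub>F N in sequentially. (\<Sum>n=N..<2*N+2. f (n+2)) \<le> real (N+2) * f (N+2)"
      by simp
  qed (simp add: sum_nonneg pos)
  have "filterlim (\<lambda>N::nat. 2*N+2) at_top sequentially"
    by (rule filterlim_subseq) (auto simp: strict_mono_def)
  then have alt: "(\<lambda>N. \<Sum>n<2*N+2. (-1)^n * f (n+2)) \<longlonglongrightarrow> (\<Sum>n. (-1)^n * f (n+2))"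
    using summable_LIMSEQ[OF summ] filterlim_compose by blast
  have "(\<Sum>n<N. f (n+2) - 2 * f (2*(n+2)))
        = 2 * f 2 - (\<Sum>n=N..<2*N+2. f (n+2)) - (\<Sum>n<2*N+2. (-1)^n * f (n+2))" for N
    using alternating_plus_doubling_partial_sums[where f = f and N = N] by linarith
  then show "(\<lambda>n. f (n+2) - 2 * f (2*(n+2))) sums (2 * f 2 - (\<Sum>n. (-1)^n * f (n+2)))"
    unfolding sums_def
    using tendsto_diff[OF tendsto_diff[OF tendsto_const[of "2 * f 2"] block] alt] by simp
qed

lemma log_series:
  fixes z :: real
  assumes z: "z > - ln 2"
  shows "summable (\<lambda>n. let k = n + 2 in (-1) ^ k / (real k * (ln (real k) + z)))" (is "summable ?a")
    and "summable (\<lambda>n. let k = n + 2 in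
           ln 2 / (real k * (ln (real k) + z) * (ln (2 * real k) + z)))" (is "summable ?b")
    and "(\<Sum>n. let k = n + 2 in (-1) ^ k / (real k * (ln (real k) + z)))
         + (\<Sum>n. let k = n + 2 in ln 2 / (real k * (ln (real k) + z) * (ln (2 * real k) + z)))
         = 1 / (ln 2 + z)"
proof -
  define f where "f k = 1 / (real k * (ln (real k) + z))" for k :: nat
  have L: "0 < ln (real k) + z" if "2 \<le> k" for k :: nat
  proof -
    have "ln 2 \<le> ln (real k)" using that by simp
    then show ?thesis using z by linarith
  qed
  have dec: "f n \<le> f m" if "2 \<le> m" "m \<le> n" for m n
    unfolding f_def using that L[of m] L[of n]
    by (intro divide_left_mono mult_mono) auto
  have pos: "0 \<le> f n" if "2 \<le> n" for n
    unfolding f_def using L[OF that] by simp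
  have "filterlim (\<lambda>n. z + ln (real n)) at_top sequentially"
    by (intro filterlim_tendsto_add_at_top[OF tendsto_const]
        filterlim_compose[OF ln_at_top filterlim_real_sequentially])
  then have "(\<lambda>n. 1 / (z + ln (real n))) \<longlonglongrightarrow> 0"
    by (rule real_tendsto_divide_at_top[OF tendsto_const])
  then have lim: "(\<lambda>n. real n * f n) \<longlonglongrightarrow> 0"
    by (rule Lim_transform_eventually)
      (rule eventually_sequentiallyI[of 1], simp add: f_def add.commute)
  have a: "?a = (\<lambda>n. (-1)^n * f (n+2))"
    by (simp add: f_def Let_def)
  have "?b n = f (n+2) - 2 * f (2*(n+2))" for n
  proof -
    define k where "k = n + 2"
    define l where "l = ln (real k) + z"
    have "ln (2 * real k) = ln 2 + ln (real k)"
      by (rule ln_mult_pos) (simp_all add: k_def)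
    then have l2: "ln (2 * real k) + z = l + ln 2"
      by (simp add: l_def)
    have "0 < l" "0 < real k"
      using L[of k] by (auto simp: l_def k_def)
    moreover have "0 < l + ln 2"
      using \<open>0 < l\<close> by (simp add: add_pos_pos)
    ultimately have "ln 2 / (real k * l * (l + ln 2))
        = 1 / (real k * l) - 2 * (1 / (2 * real k * (l + ln 2)))"
      by (simp add: divide_simps)
    then have "ln 2 / (real k * (ln (real k) + z) * (ln (2 * real k) + z)) = f k - 2 * f (2 * k)"
      using l2 by (simp add: f_def l_def add_ac)
    then show ?thesis
      unfolding Let_def k_def .
  qed
  then have b: "?b = (\<lambda>n. f (n+2) - 2 * f (2*(n+2)))"
    by (rule ext)
  note S = alternating_plus_doubling_sums[of f, OF dec pos lim]
  show "summable ?a"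
    unfolding a by (rule S(1))
  show "summable ?b"
    unfolding b by (rule sums_summable[OF S(2)])
  have "2 * f 2 = 1 / (ln 2 + z)"
    using z by (simp add: f_def divide_simps)
  then show "suminf ?a + suminf ?b = 1 / (ln 2 + z)"
    unfolding a b using sums_unique[OF S(2)] by linarith
qed

theorem mainTheorem3:
  shows "(\<forall>z::real. z > - ln 2 \<longrightarrow>
      summable (\<lambda>n. let k = n + 2 in (-1) ^ k / (real k * (ln (real k) + z))) \<and>
      summable (\<lambda>n. let k = n + 2 in ln 2 / (real k * (ln (real k) + z) * (ln (2 * real k) + z))) \<and>
      (\<Sum>n. let k = n + 2 in (-1) ^ k / (real k * (ln (real k) + z)))
        + (\<Sum>n. let k = n + 2 in ln 2 / (real k * (ln (real k) + z) * (ln (2 * real k) + z)))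
        = 1 / (ln 2 + z))
    \<and> (\<forall>\<alpha>::real. \<alpha> > 1 / 2 \<longrightarrow>
      summable (\<lambda>n. let k = n + 2 in (-1) ^ k / (real k * ln (\<alpha> * real k))) \<and>
      summable (\<lambda>n. let k = n + 2 in ln 2 / (real k * ln (\<alpha> * real k) * ln (2 * \<alpha> * real k))) \<and>
      (\<Sum>n. let k = n + 2 in (-1) ^ k / (real k * ln (\<alpha> * real k)))
        + (\<Sum>n. let k = n + 2 in ln 2 / (real k * ln (\<alpha> * real k) * ln (2 * \<alpha> * real k)))
        = 1 / ln (2 * \<alpha>))"
proof (intro conjI allI impI)
  fix \<alpha> :: real
  assume \<alpha>: "\<alpha> > 1 / 2"
  have "ln (1/2) < ln \<alpha>" using \<alpha> by (subst ln_less_cancel_iff) auto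
  then have z: "ln \<alpha> > - ln 2" by (simp add: ln_div)
  have 1: "ln (real k) + ln \<alpha> = ln (\<alpha> * real k)" if "k \<ge> 2" for k :: nat
    using that \<alpha> by (simp add: ln_mult)
  have 2: "ln (2 * real k) + ln \<alpha> = ln (2 * \<alpha> * real k)" if "k \<ge> 2" for k :: nat
    using that \<alpha> by (simp add: ln_mult)
  have 3: "ln 2 + ln \<alpha> = ln (2 * \<alpha>)"
    using \<alpha> by (simp add: ln_mult)
  note S = log_series[OF z, unfolded Let_def 1[OF le_add2] 2[OF le_add2] 3]
  show "summable (\<lambda>n. let k = n + 2 in (-1) ^ k / (real k * ln (\<alpha> * real k)))"
    unfolding Let_def by (rule S(1))
  show "summable (\<lambda>n. let k = n + 2 in ln 2 / (real k * ln (\<alpha> * real k) * ln (2 * \<alpha> * real k)))"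
    unfolding Let_def by (rule S(2))
  show "(\<Sum>n. let k = n + 2 in (-1) ^ k / (real k * ln (\<alpha> * real k)))
        + (\<Sum>n. let k = n + 2 in ln 2 / (real k * ln (\<alpha> * real k) * ln (2 * \<alpha> * real k)))
        = 1 / ln (2 * \<alpha>)"
    unfolding Let_def by (rule S(3))
qed (rule log_series; assumption)+

end
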